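(* Consider the problem (NS) in $\Omega=\mathbb{R}\times(0,1)$ described in the context, and suppose that $\chi=1$. Let $\mathrm{Re}',\varepsilon',C_0$ be positive constants with the global existence property (E) stated in the context. Suppose that $\mathrm{Re}<\mathrm{Re}'$, $\epsilon<\varepsilon'$, and that the initial perturbation satisfies the regularity, compatibility and smallness conditions (a), (b), (c) of the context. Denote by $(\rho^\epsilon,\mathbf{u}^\epsilon,\mathcal{T}^\epsilon)$ the unique global strong solution given by (E). Then $$\|\rho^\epsilon-1\|_{L^2}=O(\epsilon^2),\quad \|\mathbf{u}^\epsilon-\tilde{\mathbf{u}}\|_{L^2}=O(\epsilon),\quad \|\mathcal{T}^\epsilon-1\|_{L^2}=O(\epsilon^2).$$ Moreover $(\tilde{\mathbf{u}},p_* )$ with $p_*:=P(1,1)$ is the incompressible Couette flow, an exact solution of the steady incompressible Navier–Stokes system $$\mathrm{div}\,\mathbf{u}=0,\quad (\mathbf{u}\cdot\nabla)\mathbf{u}+\nabla p=\mu\Delta\mathbf{u}\ \text{ in }\Omega,\quad \mathbf{u}|_{x_2=1}=(1,0)^\top,\quad \mathbf{u}|_{x_2=0}=0.$$ Thus the global strong solution $(\rho^\epsilon,\mathbf{u}^\epsilon,\mathcal{T}^\epsilon)$ converges strongly to $(1,\tilde{\mathbf{u}},1)$, i.e. the incompressible Couette flow, in the $L^2$ space as $\epsilon\to0$.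
   Context: Domain and norms: $\Omega=\mathbb{R}\times(0,1)$, $\mathbf{x}=(x_1,x_2)$; $\|\cdot\|_{L^q}$, $\|\cdot\|_{H^l}$ are the usual norms over $\Omega$. Parameters: $\gamma>1$, $\mathrm{Ma},\mathrm{Re},\mathrm{Pr},C_p>0$, $\epsilon=\sqrt{\gamma}\,\mathrm{Ma}$, $\mu=1/\mathrm{Re}$, $\mu+\mu'\ge 0$ with the ratio $\mu'/\mu$ a fixed constant, $\kappa=C_p/(\mathrm{Re}\,\mathrm{Pr})$, and $\chi>0$ a given constant (temperature of the lower wall). $P(\rho,\mathcal{T})=\rho\mathcal{T}$, $\mathfrak{D}(\mathbf{u})=\frac12(\nabla\mathbf{u}+(\nabla\mathbf{u})^\top)$. Problem (NS): unknown density $\rho$, velocity $\mathbf{u}=(u^1,u^2)^\top$, temperature $\mathcal{T}$ on $\Omega\times[0,\infty)$ with $$\partial_t\rho+\mathrm{div}(\rho\mathbf{u})=0,$$ $$\rho(\partial_t\mathbf{u}+(\mathbf{u}\cdot\nabla)\mathbf{u})+\epsilon^{-2}\nabla P(\rho,\mathcal{T})=\mu\Delta\mathbf{u}+(\mu+\mu')\nabla\mathrm{div}\,\mathbf{u},$$ $$\frac{\rho}{\gamma-1}(\partial_t\mathcal{T}+\mathbf{u}\cdot\nabla\mathcal{T})+P(\rho,\mathcal{T})\mathrm{div}\,\mathbf{u}=\kappa\Delta\mathcal{T}+\epsilon^2\big(2\mu|\mathfrak{D}(\mathbf{u})|^2+\mu'(\mathrm{div}\,\mathbf{u})^2\big),$$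 boundary conditions $\mathbf{u}=(1,0)^\top$, $\mathcal{T}=1$ on $x_2=1$ and $\mathbf{u}=0$, $\mathcal{T}=\chi$ on $x_2=0$ for $t>0$, and initial condition $(\rho,\mathbf{u},\mathcal{T})(\cdot,0)=(\rho_0,\mathbf{u}_0,\mathcal{T}_0)$. Couette flow: $\tilde{\mathcal{T}}=\chi+(1-\chi)x_2-\frac{\epsilon^2\mathrm{Pr}}{2C_p}(x_2^2-x_2)$, $\tilde{\mathbf{u}}=(x_2,0)^\top$, $\tilde\rho=1/\tilde{\mathcal{T}}$. Perturbation: $(\varphi,\boldsymbol{\psi},\theta)(t)=(\rho(t)-\tilde\rho,\mathbf{u}(t)-\tilde{\mathbf{u}},\mathcal{T}(t)-\tilde{\mathcal{T}})$; $\partial_t\varphi(0),\partial_t\boldsymbol{\psi}(0),\partial_t\theta(0)$ are defined by evaluating the equations of (NS) at $t=0$. Conditions on the initial perturbation: (a) $\varphi(0)\in H^3(\Omega)$, $\boldsymbol{\psi}(0),\theta(0)\in H^1_0(\Omega)\cap H^3(\Omega)$. (b) $\partial_t\boldsymbol{\psi}(0)=0$ and $\partial_t\theta(0)=0$ on $\partial\Omega$. (c) $$\|\boldsymbol{\psi}(0)\|^2_{L^2}+\epsilon^{2}\|\nabla\boldsymbol{\psi}(0)\|^2_{L^2}+\epsilon^{4}\|(\nabla^2\boldsymbol{\psi},\partial_t\boldsymbol{\psi})(0)\|^2_{L^2}+\epsilon^{6}\|(\nabla^3\boldsymbol{\psi},\nabla\partial_t\boldsymbol{\psi})(0)\|^2_{L^2}\leq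 C_0\epsilon^2,$$ $$\|\varphi(0)\|^2_{L^2}+\epsilon^{2}\|\nabla\varphi(0)\|^2_{L^2}+\epsilon^{4}\|(\nabla^2\varphi,\partial_t\varphi)(0)\|^2_{L^2}+\epsilon^{6}\|\nabla^3\varphi(0)\|^2_{L^2}\leq C_0\epsilon^4,$$ $$\|\theta(0)\|^2_{L^2}+\epsilon^{2}\|\nabla\theta(0)\|^2_{L^2}+\epsilon^{4}\|(\nabla^2\theta,\partial_t\theta)(0)\|^2_{L^2}+\epsilon^{6}\|(\nabla^3\theta,\nabla\partial_t\theta)(0)\|^2_{L^2}\leq C_0\epsilon^4.$$ Property (E) (the global existence theorem of the paper, valid for suitable $\mathrm{Re}',\varepsilon',C_0>0$, with $\varepsilon'$ depending on $\mathrm{Re}$ and $C_0$ depending on $\mathrm{Re}$ but not on $\epsilon$): if $|1-\chi|=O(\epsilon)$, $\mathrm{Re}<\mathrm{Re}'$, $\epsilon<\varepsilon'$ and (a), (b), (c) hold, then (NS) has a unique global strong solution with $\varphi\in C([0,\infty);H^3)$, $\boldsymbol{\psi},\theta\in C([0,\infty);H^3)\cap L^2([0,\infty);H^4)$, and, with some $\widehat{C}>0$ independent of $\epsilon$, $\sup_{t\ge0}(\epsilon^{-1}\|\varphi\|_{L^2}+\|\boldsymbol{\psi}\|_{L^2}+\epsilon^{-1}\|\theta\|_{L^2})\le\widehat{C}\epsilon$ and $\sup_{t\ge0}(\epsilon^{-1}\|\nabla\varphi\|_{L^2}+\|\nabla\boldsymbol{\psi}\|_{L^2}+\epsilon^{-1}\|\nabla\theta\|_{L^2})\le\widehat{C}$;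 moreover $\|(\mathbf{u}(t)-\tilde{\mathbf{u}},\mathcal{T}(t)-\tilde{\mathcal{T}})\|_{L^\infty}\to0$ as $t\to\infty$. $O(\epsilon^k)$ denotes a quantity bounded in absolute value by $C\epsilon^k$ with $C>0$ independent of $\epsilon$ and time.
   Formalization: ρ−1 and T−1 are never in L² of the infinite strip (T̃−1 is a nonzero function of x₂ alone), so their O(ε²) bounds and limits are stated in L² of unit-length windows, uniformly in position, with O(ε²) bounds for ρ−ρ̃ and T−T̃ in L²(Ω). *)

theory Defs
  imports "HOL-Analysis.Analysis" "HOL-Probability.Essential_Supremum"
begin

section \<open>The strip and its function spaces\<close>

type_synonym R2 = "real \<times> real"

definition strip :: "R2 set" where
  "strip = UNIV \<times> {0<..<1}"

definition esqrt :: "ennreal \<Rightarrow> ennreal" where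
  "esqrt a = (if a = \<infinity> then \<infinity> else ennreal (sqrt (enn2real a)))"

text \<open>All norms are extended-real valued, so that a bound on a norm also says that it is finite.\<close>

definition L2_norm :: "R2 set \<Rightarrow> (R2 \<Rightarrow> 'b::real_normed_vector) \<Rightarrow> ennreal" where
  "L2_norm S f = esqrt (\<integral>\<^sup>+ x \<in> S. ennreal ((norm (f x))\<^sup>2) \<partial>lebesgue)"

definition L2_space :: "R2 set \<Rightarrow> (R2 \<Rightarrow> 'b::real_normed_vector) set" where
  "L2_space S = {f. set_borel_measurable lebesgue S f \<and> L2_norm S f < \<infinity>}"

text \<open>
  The uniformly local \<open>L\<^sup>2\<close> norm on the strip. The Couette temperature and density differ from
  the constant \<open>1\<close> by a function of \<open>x\<^sub>2\<close> alone, which is not in \<open>L\<^sup>2\<close> of the unbounded strip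
  (see \<open>temp_minus_one_not_L2\<close> and \<open>dens_minus_one_not_L2\<close> below); the \<open>L\<^sup>2\<close> size of such functions
  is therefore measured on windows of unit length, uniformly in the position of the window.
\<close>

definition L2_uloc :: "(R2 \<Rightarrow> 'b::real_normed_vector) \<Rightarrow> ennreal" where
  "L2_uloc f = (SUP a. L2_norm ({a<..<a + 1} \<times> {0<..<1}) f)"

definition Linf_norm :: "(R2 \<Rightarrow> 'b::real_normed_vector) \<Rightarrow> ennreal" where
  "Linf_norm f = esssup (restrict_space lebesgue strip) (\<lambda>x. ennreal (norm (f x)))"

definition pd :: "R2 \<Rightarrow> (R2 \<Rightarrow> real) \<Rightarrow> R2 \<Rightarrow> real" where
  "pd e f x = frechet_derivative f (at x) e"

text \<open>Continuous differentiability of order \<open>k\<close>; only meant for open \<open>S\<close>.\<close>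

fun Ck_on :: "nat \<Rightarrow> R2 set \<Rightarrow> (R2 \<Rightarrow> real) \<Rightarrow> bool" where
  "Ck_on 0 S f \<longleftrightarrow> continuous_on S f"
| "Ck_on (Suc k) S f \<longleftrightarrow> f differentiable_on S \<and> (\<forall>e\<in>Basis. Ck_on k S (pd e f))"

definition test_function :: "(R2 \<Rightarrow> real) \<Rightarrow> bool" where
  "test_function g \<longleftrightarrow> (\<forall>k. Ck_on k UNIV g) \<and>
     compact (closure {x. g x \<noteq> 0}) \<and> closure {x. g x \<noteq> 0} \<subseteq> strip"

definition locally_integrable :: "(R2 \<Rightarrow> real) \<Rightarrow> bool" where
  "locally_integrable f \<longleftrightarrow> (\<forall>K. compact K \<and> K \<subseteq> strip \<longrightarrow> set_integrable lebesgue K f)"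

definition weak_deriv :: "R2 \<Rightarrow> (R2 \<Rightarrow> real) \<Rightarrow> (R2 \<Rightarrow> real) \<Rightarrow> bool" where
  "weak_deriv e f g \<longleftrightarrow> locally_integrable f \<and> locally_integrable g \<and>
     (\<forall>h. test_function h \<longrightarrow>
        (LINT x:strip|lebesgue. f x * pd e h x) = - (LINT x:strip|lebesgue. g x * h x))"

text \<open>
  A representative of the weak derivative, which is unique up to a null set. It is unspecified
  where no weak derivative exists; the spaces below ask for existence explicitly.
\<close>

definition D :: "R2 \<Rightarrow> (R2 \<Rightarrow> real) \<Rightarrow> R2 \<Rightarrow> real" where
  "D e f = (SOME g. weak_deriv e f g)"

fun H :: "nat \<Rightarrow> (R2 \<Rightarrow> real) set" where
  "H 0 = L2_space strip"
| "H (Suc k) = {f \<in> L2_space strip. \<forall>e\<in>Basis. (\<exists>g. weak_deriv e f g) \<and> D e f \<in> H k}"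

text \<open>\<open>grad_sq k f\<close> is \<open>\<parallel>\<nabla>\<^sup>k f\<parallel>\<^sup>2\<close> in \<open>L\<^sup>2\<close> of the strip, and \<open>vgrad_sq\<close> its version for vector fields.\<close>

fun grad_sq :: "nat \<Rightarrow> (R2 \<Rightarrow> real) \<Rightarrow> ennreal" where
  "grad_sq 0 f = (\<integral>\<^sup>+ x \<in> strip. ennreal ((f x)\<^sup>2) \<partial>lebesgue)"
| "grad_sq (Suc k) f = (\<Sum>e\<in>Basis. grad_sq k (D e f))"

definition cmpt :: "(R2 \<Rightarrow> R2) \<Rightarrow> R2 \<Rightarrow> R2 \<Rightarrow> real" where
  "cmpt u e = (\<lambda>x. u x \<bullet> e)"

definition vgrad_sq :: "nat \<Rightarrow> (R2 \<Rightarrow> R2) \<Rightarrow> ennreal" where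
  "vgrad_sq k u = (\<Sum>e\<in>Basis. grad_sq k (cmpt u e))"

definition H_norm_sq :: "nat \<Rightarrow> (R2 \<Rightarrow> real) \<Rightarrow> ennreal" where
  "H_norm_sq k f = (\<Sum>j\<le>k. grad_sq j f)"

text \<open>
  The closure of the test functions in \<open>H\<^sup>1\<close>. For \<open>f\<close> in \<open>H\<^sup>1\<close>, membership in this space is what
  ``\<open>f = 0\<close> on the boundary'' means.
\<close>

definition H10 :: "(R2 \<Rightarrow> real) set" where
  "H10 = {f \<in> H 1. \<exists>g. (\<forall>n::nat. test_function (g n)) \<and>
            (\<lambda>n. H_norm_sq 1 (\<lambda>x. f x - g n x)) \<longlonglongrightarrow> 0}"

definition vec_in :: "(R2 \<Rightarrow> R2) \<Rightarrow> (R2 \<Rightarrow> real) set \<Rightarrow> bool" where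
  "vec_in u X \<longleftrightarrow> (\<forall>e\<in>Basis. cmpt u e \<in> X)"

definition C_in_H :: "nat \<Rightarrow> (real \<Rightarrow> R2 \<Rightarrow> real) \<Rightarrow> bool" where
  "C_in_H k f \<longleftrightarrow> (\<forall>t\<ge>0. f t \<in> H k \<and>
     ((\<lambda>s. H_norm_sq k (\<lambda>x. f s x - f t x)) \<longlongrightarrow> 0) (at t within {0..}))"

definition L2_in_H :: "nat \<Rightarrow> (real \<Rightarrow> R2 \<Rightarrow> real) \<Rightarrow> bool" where
  "L2_in_H k f \<longleftrightarrow> (AE t\<in>{0..} in lebesgue. f t \<in> H k) \<and>
     (\<integral>\<^sup>+ t \<in> {0..}. H_norm_sq k (f t) \<partial>lebesgue) < \<infinity>"

text \<open>Time derivative at \<open>t \<ge> 0\<close>, as a limit of difference quotients in \<open>L\<^sup>2\<close> of the strip.\<close>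

definition has_time_deriv ::
    "(real \<Rightarrow> R2 \<Rightarrow> 'b::real_normed_vector) \<Rightarrow> (R2 \<Rightarrow> 'b) \<Rightarrow> real \<Rightarrow> bool" where
  "has_time_deriv f g t \<longleftrightarrow> g \<in> L2_space strip \<and>
     ((\<lambda>s. L2_norm strip (\<lambda>x. (f s x - f t x) /\<^sub>R (s - t) - g x)) \<longlongrightarrow> 0) (at t within {0..})"

text \<open>Boundary values, attained by the representative that is continuous up to the boundary.\<close>

definition boundary_values :: "(R2 \<Rightarrow> 'b::real_normed_vector) \<Rightarrow> 'b \<Rightarrow> 'b \<Rightarrow> bool" where
  "boundary_values f upper lower \<longleftrightarrow>
     (\<exists>v. continuous_on (closure strip) v \<and> (AE x\<in>strip in lebesgue. v x = f x) \<and>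
          (\<forall>a. v (a, 1) = upper \<and> v (a, 0) = lower))"


section \<open>The compressible Navier-Stokes problem\<close>

text \<open>\<open>ratio\<close> is the quotient \<open>\<mu>' / \<mu>\<close> and \<open>chi\<close> the temperature of the lower wall.\<close>

record flow_params =
  gamma :: real
  Mach :: real
  Reynolds :: real
  Prandtl :: real
  C_p :: real
  ratio :: real
  chi :: real

definition eps :: "flow_params \<Rightarrow> real" where "eps p = sqrt (gamma p) * Mach p"
definition mu :: "flow_params \<Rightarrow> real" where "mu p = 1 / Reynolds p"
definition mu' :: "flow_params \<Rightarrow> real" where "mu' p = ratio p * mu p"
definition kappa :: "flow_params \<Rightarrow> real" where "kappa p = C_p p / (Reynolds p * Prandtl p)"

definition admissible :: "flow_params \<Rightarrow> bool" where
  "admissible p \<longleftrightarrow> gamma p > 1 \<and> Mach p > 0 \<and> Reynolds p > 0 \<and> Prandtl p > 0 \<and> C_p p > 0 \<and>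
     mu p + mu' p \<ge> 0 \<and> chi p > 0"

record state =
  dens :: "R2 \<Rightarrow> real"
  vel :: "R2 \<Rightarrow> R2"
  temp :: "R2 \<Rightarrow> real"

definition pressure :: "real \<Rightarrow> real \<Rightarrow> real" where
  "pressure r T = r * T"

definition divg :: "(R2 \<Rightarrow> R2) \<Rightarrow> R2 \<Rightarrow> real" where
  "divg u x = (\<Sum>e\<in>Basis. D e (cmpt u e) x)"

definition laplace :: "(R2 \<Rightarrow> real) \<Rightarrow> R2 \<Rightarrow> real" where
  "laplace f x = (\<Sum>e\<in>Basis. D e (D e f) x)"

text \<open>\<open>advect u f\<close> is \<open>(u \<cdot> \<nabla>) f\<close>; \<open>strain_sq u\<close> is the squared Frobenius norm of
  \<open>(\<nabla>u + (\<nabla>u)\<^sup>T) / 2\<close>.\<close>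

definition advect :: "(R2 \<Rightarrow> R2) \<Rightarrow> (R2 \<Rightarrow> real) \<Rightarrow> R2 \<Rightarrow> real" where
  "advect u f x = (\<Sum>e\<in>Basis. cmpt u e x * D e f x)"

definition strain_sq :: "(R2 \<Rightarrow> R2) \<Rightarrow> R2 \<Rightarrow> real" where
  "strain_sq u x = (\<Sum>i\<in>Basis. \<Sum>j\<in>Basis. ((D i (cmpt u j) x + D j (cmpt u i) x) / 2)\<^sup>2)"

text \<open>
  \<open>NS_equations p s w\<close>: the three balance laws hold almost everywhere in the strip when the fields
  at a given time are \<open>s\<close> and their time derivatives are \<open>w\<close>. For given \<open>s\<close> with nonvanishing density
  this determines \<open>w\<close> almost everywhere.
\<close>

definition NS_equations :: "flow_params \<Rightarrow> state \<Rightarrow> state \<Rightarrow> bool" where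
  "NS_equations p s w \<longleftrightarrow>
     (let \<rho> = dens s; u = vel s; T = temp s; P = (\<lambda>x. pressure (\<rho> x) (T x)) in
      AE x\<in>strip in lebesgue.
        dens w x + divg (\<lambda>y. \<rho> y *\<^sub>R u y) x = 0 \<and>
        (\<forall>e\<in>Basis.
           \<rho> x * (cmpt (vel w) e x + advect u (cmpt u e) x) + D e P x / (eps p)\<^sup>2
             = mu p * laplace (cmpt u e) x + (mu p + mu' p) * D e (divg u) x) \<and>
        \<rho> x / (gamma p - 1) * (temp w x + advect u T x) + P x * divg u x
          = kappa p * laplace T x
            + (eps p)\<^sup>2 * (2 * mu p * strain_sq u x + mu' p * (divg u x)\<^sup>2))"

definition couette_vel :: "R2 \<Rightarrow> R2" where
  "couette_vel x = (snd x, 0)"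

definition couette_temp :: "flow_params \<Rightarrow> R2 \<Rightarrow> real" where
  "couette_temp p x = chi p + (1 - chi p) * snd x
     - (eps p)\<^sup>2 * Prandtl p / (2 * C_p p) * ((snd x)\<^sup>2 - snd x)"

definition couette_dens :: "flow_params \<Rightarrow> R2 \<Rightarrow> real" where
  "couette_dens p x = 1 / couette_temp p x"

definition perturbation :: "flow_params \<Rightarrow> state \<Rightarrow> state" where
  "perturbation p s =
     \<lparr> dens = (\<lambda>x. dens s x - couette_dens p x),
       vel = (\<lambda>x. vel s x - couette_vel x),
       temp = (\<lambda>x. temp s x - couette_temp p x) \<rparr>"

definition strong_solution :: "flow_params \<Rightarrow> state \<Rightarrow> (real \<Rightarrow> state) \<Rightarrow> bool" where
  "strong_solution p s0 s \<longleftrightarrow>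
     C_in_H 3 (\<lambda>t. dens (perturbation p (s t))) \<and>
     (\<forall>e\<in>Basis. C_in_H 3 (\<lambda>t. cmpt (vel (perturbation p (s t))) e) \<and>
                 L2_in_H 4 (\<lambda>t. cmpt (vel (perturbation p (s t))) e)) \<and>
     C_in_H 3 (\<lambda>t. temp (perturbation p (s t))) \<and>
     L2_in_H 4 (\<lambda>t. temp (perturbation p (s t))) \<and>
     (\<forall>t\<ge>0. \<exists>w. has_time_deriv (\<lambda>t. dens (s t)) (dens w) t \<and>
                 has_time_deriv (\<lambda>t. vel (s t)) (vel w) t \<and>
                 has_time_deriv (\<lambda>t. temp (s t)) (temp w) t \<and>
                 NS_equations p (s t) w) \<and>
     (\<forall>t>0. boundary_values (vel (s t)) (1, 0) 0 \<and> boundary_values (temp (s t)) 1 (chi p)) \<and>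
     (AE x\<in>strip in lebesgue.
        dens (s 0) x = dens s0 x \<and> vel (s 0) x = vel s0 x \<and> temp (s 0) x = temp s0 x)"

text \<open>
  Regularity, compatibility and smallness of the initial perturbation. As the Couette flow is steady,
  the initial time derivative of the perturbation is the one of the full state, namely the \<open>w\<close>
  obtained by evaluating the equations at the initial state.
\<close>

definition initial_conditions :: "flow_params \<Rightarrow> real \<Rightarrow> state \<Rightarrow> bool" where
  "initial_conditions p C0 s0 \<longleftrightarrow>
     (let \<epsilon> = eps p; \<phi> = dens (perturbation p s0); \<psi> = vel (perturbation p s0);
          \<theta> = temp (perturbation p s0) in
      (\<phi> \<in> H 3 \<and> vec_in \<psi> (H10 \<inter> H 3) \<and> \<theta> \<in> H10 \<inter> H 3) \<and>
      (\<exists>w. NS_equations p s0 w \<and>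
         (vec_in (vel w) H10 \<and> temp w \<in> H10) \<and>
         (vgrad_sq 0 \<psi> + ennreal (\<epsilon>^2) * vgrad_sq 1 \<psi>
            + ennreal (\<epsilon>^4) * (vgrad_sq 2 \<psi> + vgrad_sq 0 (vel w))
            + ennreal (\<epsilon>^6) * (vgrad_sq 3 \<psi> + vgrad_sq 1 (vel w)) \<le> ennreal (C0 * \<epsilon>^2) \<and>
          grad_sq 0 \<phi> + ennreal (\<epsilon>^2) * grad_sq 1 \<phi>
            + ennreal (\<epsilon>^4) * (grad_sq 2 \<phi> + grad_sq 0 (dens w))
            + ennreal (\<epsilon>^6) * grad_sq 3 \<phi> \<le> ennreal (C0 * \<epsilon>^4) \<and>
          grad_sq 0 \<theta> + ennreal (\<epsilon>^2) * grad_sq 1 \<theta>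
            + ennreal (\<epsilon>^4) * (grad_sq 2 \<theta> + grad_sq 0 (temp w))
            + ennreal (\<epsilon>^6) * (grad_sq 3 \<theta> + grad_sq 1 (temp w)) \<le> ennreal (C0 * \<epsilon>^4))))"

definition uniform_bounds :: "flow_params \<Rightarrow> real \<Rightarrow> (real \<Rightarrow> state) \<Rightarrow> bool" where
  "uniform_bounds p C s \<longleftrightarrow>
     (SUP t\<in>{0..}. ennreal (1 / eps p) * L2_norm strip (dens (perturbation p (s t)))
         + L2_norm strip (vel (perturbation p (s t)))
         + ennreal (1 / eps p) * L2_norm strip (temp (perturbation p (s t)))) \<le> ennreal (C * eps p) \<and>
     (SUP t\<in>{0..}. ennreal (1 / eps p) * esqrt (grad_sq 1 (dens (perturbation p (s t))))
         + esqrt (vgrad_sq 1 (vel (perturbation p (s t))))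
         + ennreal (1 / eps p) * esqrt (grad_sq 1 (temp (perturbation p (s t))))) \<le> ennreal C"

definition decays :: "flow_params \<Rightarrow> (real \<Rightarrow> state) \<Rightarrow> bool" where
  "decays p s \<longleftrightarrow>
     ((\<lambda>t. Linf_norm (\<lambda>x. (vel (perturbation p (s t)) x, temp (perturbation p (s t)) x))) \<longlongrightarrow> 0) at_top"

definition same_solution :: "(real \<Rightarrow> state) \<Rightarrow> (real \<Rightarrow> state) \<Rightarrow> bool" where
  "same_solution s s' \<longleftrightarrow> (\<forall>t\<ge>0. AE x\<in>strip in lebesgue.
     dens (s t) x = dens (s' t) x \<and> vel (s t) x = vel (s' t) x \<and> temp (s t) x = temp (s' t) x)"

text \<open>
  The global existence property. Of the record \<open>p\<close> only \<open>gamma\<close>, \<open>Prandtl\<close>, \<open>C_p\<close> and \<open>ratio\<close> are used: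
  the Reynolds number \<open>R\<close>, the Mach number \<open>m\<close> and the wall temperature \<open>c\<close> vary, and \<open>K\<close> is the
  constant implicit in \<open>|1 - \<chi>| = O(\<epsilon>)\<close>. The thresholds \<open>\<epsilon>'\<close> and \<open>C\<^sub>0\<close> are functions of the Reynolds
  number; the constant of the bounds depends on neither the Mach number nor the data.
\<close>

definition global_existence ::
    "real \<Rightarrow> flow_params \<Rightarrow> real \<Rightarrow> (real \<Rightarrow> real) \<Rightarrow> (real \<Rightarrow> real) \<Rightarrow> bool" where
  "global_existence K p Re' eps' C0 \<longleftrightarrow>
     (\<forall>R. 0 < R \<and> R < Re' \<longrightarrow>
       (\<exists>C>0. \<forall>m c s0. let q = p\<lparr>Reynolds := R, Mach := m, chi := c\<rparr> in
          0 < m \<and> 0 < c \<and> \<bar>1 - c\<bar> \<le> K * eps q \<and> eps q < eps' R \<and>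
          initial_conditions q (C0 R) s0 \<longrightarrow>
            (\<exists>s. strong_solution q s0 s \<and> uniform_bounds q C s \<and> decays q s) \<and>
            (\<forall>s s'. strong_solution q s0 s \<and> strong_solution q s0 s' \<longrightarrow> same_solution s s')))"


section \<open>The steady incompressible Navier-Stokes system\<close>

definition steady_incompressible_NS :: "real \<Rightarrow> (R2 \<Rightarrow> R2) \<Rightarrow> (R2 \<Rightarrow> real) \<Rightarrow> bool" where
  "steady_incompressible_NS \<mu> u P \<longleftrightarrow>
     (\<forall>e\<in>Basis. Ck_on 2 strip (cmpt u e)) \<and> Ck_on 1 strip P \<and> continuous_on (closure strip) u \<and>
     (\<forall>x\<in>strip. (\<Sum>e\<in>Basis. pd e (cmpt u e) x) = 0 \<and>
        (\<forall>e\<in>Basis. (\<Sum>j\<in>Basis. cmpt u j x * pd j (cmpt u e) x) + pd e P x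
                     = \<mu> * (\<Sum>j\<in>Basis. pd j (pd j (cmpt u e)) x))) \<and>
     (\<forall>a. u (a, 1) = (1, 0) \<and> u (a, 0) = 0)"


section \<open>Why the deviation from \<open>1\<close> is measured locally\<close>

lemma not_L2_strip:
  fixes f g :: "R2 \<Rightarrow> real"
  assumes diff: "(\<lambda>x. f x - g x) \<in> L2_space strip"
    and gm: "set_borel_measurable lebesgue strip g"
    and \<delta>: "0 < \<delta>" "\<And>x. snd x \<in> {1/4..3/4} \<Longrightarrow> \<delta> \<le> \<bar>g x\<bar>"
  shows "L2_norm strip f = \<infinity>"
proof -
  let ?A = "(UNIV :: real set) \<times> {1/4..3/4::real}"
  let ?d = "\<lambda>x. indicator strip x *\<^sub>R (f x - g x)" and ?g = "\<lambda>x. indicator strip x *\<^sub>R g x"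
  let ?h = "\<lambda>x. ennreal ((norm (f x - g x))\<^sup>2) * indicator strip x"
  let ?F = "\<lambda>x. ennreal ((norm (f x))\<^sup>2) * indicator strip x"
  have A: "?A \<in> sets lebesgue"
    by (intro sets_completionI_sets) (simp add: borel_closed closed_Times)
  have "emeasure lebesgue ?A = emeasure lborel ?A"
    by (simp add: borel_closed closed_Times)
  also have "\<dots> = emeasure lborel (UNIV :: real set) * emeasure lborel {1/4..3/4::real}"
    unfolding lborel_prod[symmetric] by (subst lborel.emeasure_pair_measure_Times) auto
  also have "\<dots> = \<infinity>"
    by (simp add: ennreal_top_mult)
  finally have top: "emeasure lebesgue ?A = \<infinity>" .
  have [measurable]: "?d \<in> borel_measurable lebesgue" "?g \<in> borel_measurable lebesgue"
    using diff gm unfolding L2_space_def set_borel_measurable_def by auto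
  have heq: "?h = (\<lambda>x. ennreal ((norm (?d x))\<^sup>2))"
    by (auto simp: indicator_def)
  have Feq: "?F = (\<lambda>x. ennreal ((norm (?d x + ?g x))\<^sup>2))"
    by (auto simp: indicator_def)
  have hm: "?h \<in> borel_measurable lebesgue" unfolding heq by measurable
  have Fm: "?F \<in> borel_measurable lebesgue" unfolding Feq by measurable
  have hfin: "(\<integral>\<^sup>+ x. ?h x \<partial>lebesgue) < \<infinity>"
    using diff unfolding L2_space_def L2_norm_def esqrt_def by (auto split: if_splits simp: less_top)
  have pointwise: "ennreal (\<delta>\<^sup>2) * indicator ?A x \<le> 2 * ?F x + 2 * ?h x" for x
  proof (cases "x \<in> ?A")
    case True
    have *: "\<delta> \<le> \<bar>g x\<bar>" using \<delta>(2)[of x] True by auto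
    have "\<delta>\<^sup>2 \<le> (g x)\<^sup>2"
      using * \<delta>(1) by (simp add: abs_le_square_iff[symmetric])
    also have "\<dots> \<le> 2 * (f x)\<^sup>2 + 2 * (f x - g x)\<^sup>2"
      using zero_le_power2[of "2 * f x - g x"] by (simp add: power2_eq_square algebra_simps)
    finally have "ennreal (\<delta>\<^sup>2) \<le> ennreal (2 * (f x)\<^sup>2 + 2 * (f x - g x)\<^sup>2)"
      by (rule ennreal_leI)
    also have "\<dots> = 2 * ennreal ((f x)\<^sup>2) + 2 * ennreal ((f x - g x)\<^sup>2)"
      by (simp add: ennreal_plus ennreal_mult)
    finally show ?thesis
      using True by (auto simp: strip_def indicator_def)
  qed simp
  have "\<infinity> = ennreal (\<delta>\<^sup>2) * emeasure lebesgue ?A"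
    using \<delta>(1) top by (simp add: ennreal_mult_top)
  also have "\<dots> = (\<integral>\<^sup>+ x. ennreal (\<delta>\<^sup>2) * indicator ?A x \<partial>lebesgue)"
    using A by (simp add: nn_integral_cmult_indicator)
  also have "\<dots> \<le> (\<integral>\<^sup>+ x. 2 * ?F x + 2 * ?h x \<partial>lebesgue)"
    by (intro nn_integral_mono pointwise)
  also have "\<dots> = 2 * (\<integral>\<^sup>+ x. ?F x \<partial>lebesgue) + 2 * (\<integral>\<^sup>+ x. ?h x \<partial>lebesgue)"
    using hm Fm by (simp add: nn_integral_add nn_integral_cmult)
  finally have "(\<integral>\<^sup>+ x. ?F x \<partial>lebesgue) = \<infinity>"
    using hfin by (auto simp: top_unique ennreal_mult_eq_top_iff less_top)
  then show ?thesis
    unfolding L2_norm_def esqrt_def by simp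
qed

lemma couette_gap_pos:
  assumes "admissible p"
  shows "0 < (eps p)\<^sup>2 * Prandtl p / (2 * C_p p) * (3/16)"
proof -
  have "0 < eps p" "0 < Prandtl p" "0 < C_p p"
    using assms by (auto simp: admissible_def eps_def)
  then show ?thesis by simp
qed

lemma couette_temp_ge:
  assumes "admissible p" "chi p = 1" "snd x \<in> {1/4..3/4}"
  shows "1 + (eps p)\<^sup>2 * Prandtl p / (2 * C_p p) * (3/16) \<le> couette_temp p x"
proof -
  define c where "c = (eps p)\<^sup>2 * Prandtl p / (2 * C_p p)"
  have "3/16 \<le> snd x - (snd x)\<^sup>2"
    using assms(3) mult_nonneg_nonneg[of "snd x - 1/4" "3/4 - snd x"]
    by (simp add: power2_eq_square algebra_simps)
  moreover have "0 \<le> c"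
    using assms(1) by (simp add: admissible_def c_def)
  ultimately have "c * (3/16) \<le> c * (snd x - (snd x)\<^sup>2)"
    by (intro mult_left_mono)
  moreover have "couette_temp p x = 1 + c * (snd x - (snd x)\<^sup>2)"
    unfolding couette_temp_def c_def[symmetric] using assms(2) by (simp add: algebra_simps)
  ultimately show ?thesis
    unfolding c_def[symmetric] by linarith
qed

lemma couette_temp_measurable: "couette_temp p \<in> borel_measurable lebesgue"
proof -
  define c where "c = (eps p)\<^sup>2 * Prandtl p / (2 * C_p p)"
  have "couette_temp p \<in> borel_measurable lborel"
    unfolding couette_temp_def[abs_def] c_def[symmetric]
    by (auto intro!: borel_measurable_continuous_onI continuous_intros)
  then show ?thesis by (rule measurable_completion)
qed

lemma set_borel_measurable_strip:
  fixes g :: "R2 \<Rightarrow> real"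
  assumes [measurable]: "g \<in> borel_measurable lebesgue"
  shows "set_borel_measurable lebesgue strip g"
proof -
  have [measurable]: "strip \<in> sets lebesgue"
    by (simp add: strip_def open_Times borel_open sets_completionI_sets)
  show ?thesis unfolding set_borel_measurable_def by measurable
qed

theorem temp_minus_one_not_L2:
  assumes "admissible p" "chi p = 1" "temp (perturbation p s) \<in> L2_space strip"
  shows "L2_norm strip (\<lambda>x. temp s x - 1) = \<infinity>"
proof (rule not_L2_strip)
  show "(\<lambda>x. (temp s x - 1) - (couette_temp p x - 1)) \<in> L2_space strip"
    using assms(3) by (simp add: perturbation_def)
  show "set_borel_measurable lebesgue strip (\<lambda>x. couette_temp p x - 1)"
    using couette_temp_measurable[of p] by (intro set_borel_measurable_strip) simp
  show "0 < (eps p)\<^sup>2 * Prandtl p / (2 * C_p p) * (3/16)"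
    using assms(1) by (rule couette_gap_pos)
  show "(eps p)\<^sup>2 * Prandtl p / (2 * C_p p) * (3/16) \<le> \<bar>couette_temp p x - 1\<bar>"
    if "snd x \<in> {1/4..3/4}" for x
    using couette_temp_ge[OF assms(1,2) that] by linarith
qed

theorem dens_minus_one_not_L2:
  assumes "admissible p" "chi p = 1" "dens (perturbation p s) \<in> L2_space strip"
  shows "L2_norm strip (\<lambda>x. dens s x - 1) = \<infinity>"
proof (rule not_L2_strip)
  define d where "d = (eps p)\<^sup>2 * Prandtl p / (2 * C_p p) * (3/16)"
  have d: "0 < d"
    unfolding d_def using assms(1) by (rule couette_gap_pos)
  show "(\<lambda>x. (dens s x - 1) - (couette_dens p x - 1)) \<in> L2_space strip"
    using assms(3) by (simp add: perturbation_def)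
  show "set_borel_measurable lebesgue strip (\<lambda>x. couette_dens p x - 1)"
    using couette_temp_measurable[of p] unfolding couette_dens_def[abs_def]
    by (intro set_borel_measurable_strip) simp
  show "0 < 1 - 1 / (1 + d)"
    using d by (simp add: field_simps)
  show "1 - 1 / (1 + d) \<le> \<bar>couette_dens p x - 1\<bar>" if "snd x \<in> {1/4..3/4}" for x
  proof -
    have "1 + d \<le> couette_temp p x"
      using couette_temp_ge[OF assms(1,2) that] by (simp add: d_def)
    then have "couette_dens p x \<le> 1 / (1 + d)"
      unfolding couette_dens_def using d by (intro divide_left_mono) auto
    then show ?thesis by linarith
  qed
qed

end

theory Submission
  imports Defs
begin

text \<open>
  Let \<open>\<epsilon>\<close> be \<open>eps q\<close> for the parameters \<open>q\<close> with the given Mach number. Uniqueness identifies any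
  strong solution with the one that carries the uniform bounds, so dividing those bounds by the
  weight \<open>1 / \<epsilon>\<close> puts density and temperature within \<open>O(\<epsilon>\<^sup>2)\<close>, and the velocity within \<open>O(\<epsilon>)\<close>, of
  the Couette flow in \<open>L\<^sup>2\<close> of the strip (\<open>strong_solution_near_couette\<close>). When both walls have
  temperature \<open>1\<close>, the Couette temperature exceeds \<open>1\<close> only by the viscous heating
  \<open>\<epsilon>\<^sup>2 Pr / (2 C\<^sub>p) (x\<^sub>2 - x\<^sub>2\<^sup>2)\<close>, which is \<open>O(\<epsilon>\<^sup>2)\<close> pointwise; the Couette density, its reciprocal, is
  then equally close to \<open>1\<close>. A window of unit length has measure \<open>1\<close>, so a pointwise bound is also an
  \<open>L\<^sup>2\<close> bound there, and the two deviations add up (\<open>L2_uloc_le_of_near_bounded\<close>).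

  All constants are chosen before the Mach number, the data and the time, hence
  \<open>\<epsilon> = \<surd>\<gamma> Ma \<longlongrightarrow> 0\<close> gives the limits. The Couette velocity moves fluid only along the direction in
  which it does not vary, so its divergence and its convection term vanish; it is linear, so the
  viscous term vanishes too, and a constant pressure balances the steady incompressible equations.
\<close>

section \<open>Square-integral norms\<close>

lemma esqrt_le_ennreal_iff:
  assumes "0 \<le> c"
  shows "esqrt a \<le> ennreal c \<longleftrightarrow> a \<le> ennreal (c\<^sup>2)"
proof (cases a)
  case (real r)
  then show ?thesis
    using assms by (simp add: esqrt_def real_sqrt_le_iff' ennreal_le_iff)
qed (simp add: esqrt_def top_unique)

lemma L2_norm_le_ennreal_iff:
  assumes "0 \<le> c"
  shows "L2_norm S f \<le> ennreal c
    \<longleftrightarrow> (\<integral>\<^sup>+ x \<in> S. ennreal ((norm (f x))\<^sup>2) \<partial>lebesgue) \<le> ennreal (c\<^sup>2)"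
  unfolding L2_norm_def using assms by (rule esqrt_le_ennreal_iff)

lemma L2_norm_cong_AE:
  assumes "AE x\<in>S in lebesgue. f x = g x"
  shows "L2_norm S f = L2_norm S g"
proof -
  have "(\<integral>\<^sup>+ x \<in> S. ennreal ((norm (f x))\<^sup>2) \<partial>lebesgue) = (\<integral>\<^sup>+ x \<in> S. ennreal ((norm (g x))\<^sup>2) \<partial>lebesgue)"
    by (rule nn_integral_cong_AE, use assms in eventually_elim) (auto simp: indicator_def)
  then show ?thesis by (simp add: L2_norm_def)
qed

lemma H_subset_L2_space: "H k \<subseteq> L2_space strip"
  by (cases k) auto

lemma emeasure_window: "emeasure lebesgue ({a<..<a + 1} \<times> {0<..<1::real}) = 1" for a :: real
proof -
  have "emeasure lebesgue ({a<..<a + 1} \<times> {0<..<1::real}) = emeasure lborel ({a<..<a + 1} \<times> {0<..<1::real})"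
    by (simp add: borel_open open_Times)
  also have "\<dots> = emeasure lborel {a<..<a + 1} * emeasure lborel {0<..<1::real}"
    unfolding lborel_prod[symmetric] by (subst lborel.emeasure_pair_measure_Times) auto
  finally show ?thesis by simp
qed

text \<open>
  On a window of measure \<open>1\<close> a pointwise bound \<open>b\<close> is an \<open>L\<^sup>2\<close> bound; the inequality
  \<open>(u + v)\<^sup>2 \<le> 2 u\<^sup>2 + 2 v\<^sup>2\<close> replaces the triangle inequality at the price of the factor \<open>2\<close>.
\<close>

lemma L2_uloc_le_of_near_bounded:
  fixes f g :: "R2 \<Rightarrow> real"
  assumes near: "(\<lambda>x. f x - g x) \<in> L2_space strip" "L2_norm strip (\<lambda>x. f x - g x) \<le> ennreal a"
    and bounded: "\<And>x. x \<in> strip \<Longrightarrow> \<bar>g x - c\<bar> \<le> b"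
    and nonneg: "0 \<le> a" "0 \<le> b"
  shows "L2_uloc (\<lambda>x. f x - c) \<le> ennreal (2 * (a + b))"
  unfolding L2_uloc_def
proof (rule SUP_least)
  fix z :: real
  let ?W = "{z<..<z + 1} \<times> {0<..<1::real}"
  let ?d = "\<lambda>x. indicator strip x * (f x - g x)"
  have W [measurable]: "?W \<in> sets lebesgue"
    by (simp add: open_Times borel_open sets_completionI_sets)
  have W_sub: "x \<in> strip" if "x \<in> ?W" for x
    using that by (auto simp: strip_def)
  have [measurable]: "?d \<in> borel_measurable lebesgue"
    using near(1) by (simp add: L2_space_def set_borel_measurable_def)
  have "(\<integral>\<^sup>+ x \<in> ?W. ennreal ((norm (f x - c))\<^sup>2) \<partial>lebesgue)
      \<le> (\<integral>\<^sup>+ x. 2 * ennreal ((?d x)\<^sup>2) + ennreal (2 * b\<^sup>2) * indicator ?W x \<partial>lebesgue)"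
  proof (rule nn_integral_mono)
    fix x
    show "ennreal ((norm (f x - c))\<^sup>2) * indicator ?W x
      \<le> 2 * ennreal ((?d x)\<^sup>2) + ennreal (2 * b\<^sup>2) * indicator ?W x"
    proof (cases "x \<in> ?W")
      case True
      have "(f x - c)\<^sup>2 \<le> 2 * (f x - g x)\<^sup>2 + 2 * (g x - c)\<^sup>2"
        using zero_le_power2[of "(f x - g x) - (g x - c)"] by (simp add: power2_eq_square algebra_simps)
      moreover have "(g x - c)\<^sup>2 \<le> b\<^sup>2"
        using bounded[OF W_sub[OF True]] by (metis abs_le_square_iff abs_of_nonneg nonneg(2))
      ultimately have "(f x - c)\<^sup>2 \<le> 2 * (f x - g x)\<^sup>2 + 2 * b\<^sup>2"
        by linarith
      then have "ennreal ((f x - c)\<^sup>2) \<le> ennreal (2 * (f x - g x)\<^sup>2 + 2 * b\<^sup>2)"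
        by (rule ennreal_leI)
      also have "\<dots> = 2 * ennreal ((f x - g x)\<^sup>2) + ennreal (2 * b\<^sup>2)"
        by (simp add: ennreal_plus ennreal_mult)
      finally show ?thesis
        using True W_sub[OF True] by simp
    qed simp
  qed
  also have "\<dots> = 2 * (\<integral>\<^sup>+ x. ennreal ((?d x)\<^sup>2) \<partial>lebesgue) + ennreal (2 * b\<^sup>2) * emeasure lebesgue ?W"
    by (subst nn_integral_add) (simp_all add: nn_integral_cmult nn_integral_cmult_indicator)
  also have "\<dots> \<le> 2 * ennreal (a\<^sup>2) + ennreal (2 * b\<^sup>2)"
  proof -
    have "(\<integral>\<^sup>+ x. ennreal ((?d x)\<^sup>2) \<partial>lebesgue)
        = (\<integral>\<^sup>+ x \<in> strip. ennreal ((norm (f x - g x))\<^sup>2) \<partial>lebesgue)"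
      by (rule nn_integral_cong) (simp add: indicator_def)
    also have "\<dots> \<le> ennreal (a\<^sup>2)"
      using near(2) nonneg(1) by (simp add: L2_norm_le_ennreal_iff)
    finally show ?thesis
      unfolding emeasure_window by (simp add: mult_left_mono add_mono)
  qed
  also have "\<dots> = ennreal (2 * a\<^sup>2 + 2 * b\<^sup>2)"
    by (simp add: ennreal_plus ennreal_mult)
  also have "\<dots> \<le> ennreal ((2 * (a + b))\<^sup>2)"
    using nonneg by (intro ennreal_leI) (simp add: power2_eq_square algebra_simps)
  finally show "L2_norm ?W (\<lambda>x. f x - c) \<le> ennreal (2 * (a + b))"
    using nonneg by (subst L2_norm_le_ennreal_iff) auto
qed

lemma ennreal_le_of_inverse_mult_le:
  assumes "0 < e" "ennreal (1 / e) * a \<le> ennreal (c * e)"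
  shows "a \<le> ennreal (c * e\<^sup>2)"
proof -
  have "a = ennreal e * (ennreal (1 / e) * a)"
    using assms(1) by (simp add: mult.assoc[symmetric] ennreal_mult[symmetric])
  also have "\<dots> \<le> ennreal e * ennreal (c * e)"
    using assms(2) by (rule mult_left_mono) simp
  also have "\<dots> = ennreal (c * e\<^sup>2)"
    using assms(1) by (subst ennreal_mult'[symmetric]) (simp_all add: power2_eq_square ac_simps)
  finally show ?thesis .
qed


section \<open>Viscous heating between walls of equal temperature\<close>

lemma couette_temp_bounds:
  assumes "admissible p" "chi p = 1" "x \<in> strip"
  shows "1 \<le> couette_temp p x" "couette_temp p x \<le> 1 + Prandtl p / (8 * C_p p) * (eps p)\<^sup>2"
proof -
  define c where "c = (eps p)\<^sup>2 * Prandtl p / (2 * C_p p)"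
  have eq: "couette_temp p x = 1 + c * (snd x - (snd x)\<^sup>2)"
    unfolding couette_temp_def c_def[symmetric] using assms(2) by (simp add: algebra_simps)
  have c: "0 \<le> c"
    using assms(1) by (simp add: admissible_def c_def)
  have "0 \<le> snd x * (1 - snd x)"
    using assms(3) by (intro mult_nonneg_nonneg) (auto simp: strip_def)
  then have "0 \<le> snd x - (snd x)\<^sup>2"
    by (simp add: power2_eq_square algebra_simps)
  then show "1 \<le> couette_temp p x"
    using c by (simp add: eq)
  \<comment> \<open>The heating profile peaks midway between the walls.\<close>
  have "snd x - (snd x)\<^sup>2 \<le> 1 / 4"
    using zero_le_power2[of "snd x - 1 / 2"] by (simp add: power2_eq_square algebra_simps)
  then have "c * (snd x - (snd x)\<^sup>2) \<le> c * (1 / 4)"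
    using c by (rule mult_left_mono)
  then show "couette_temp p x \<le> 1 + Prandtl p / (8 * C_p p) * (eps p)\<^sup>2"
    unfolding eq by (simp add: c_def mult.commute)
qed

lemma couette_temp_near_one:
  assumes "admissible p" "chi p = 1" "x \<in> strip"
  shows "\<bar>couette_temp p x - 1\<bar> \<le> Prandtl p / (8 * C_p p) * (eps p)\<^sup>2"
  using couette_temp_bounds[OF assms] by linarith

text \<open>Taking reciprocals contracts distances on \<open>[1, \<infinity>)\<close>, so the density inherits the bound.\<close>

lemma couette_dens_near_one:
  assumes "admissible p" "chi p = 1" "x \<in> strip"
  shows "\<bar>couette_dens p x - 1\<bar> \<le> Prandtl p / (8 * C_p p) * (eps p)\<^sup>2"
proof -
  have T: "1 \<le> couette_temp p x"
    using couette_temp_bounds(1)[OF assms] .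
  have "\<bar>couette_dens p x - 1\<bar> = (couette_temp p x - 1) / couette_temp p x"
    using T by (simp add: couette_dens_def field_simps abs_if)
  also have "\<dots> \<le> couette_temp p x - 1"
    using T by (simp add: divide_le_eq mult_le_cancel_left1)
  finally show ?thesis
    using couette_temp_bounds(2)[OF assms] by linarith
qed


section \<open>Deviation of a strong solution from the Couette flow\<close>

text \<open>
  Uniqueness transfers the bounds, which the existence property only promises for one solution, to
  every strong solution with the same data.
\<close>

lemma strong_solution_near_couette:
  assumes "admissible p" "chi p = 1" "0 < K" "Reynolds p < Re'"
    and ge: "global_existence K p Re' eps' C0"
  obtains C where "0 < C"
    and "\<And>q m s0 s t. \<lbrakk>q = p\<lparr>Mach := m\<rparr>; 0 < m; eps q < eps' (Reynolds p);
        initial_conditions q (C0 (Reynolds p)) s0; strong_solution q s0 s; 0 \<le> t\<rbrakk> \<Longrightarrow>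
      L2_norm strip (\<lambda>x. dens (s t) x - couette_dens q x) \<le> ennreal (C * (eps q)\<^sup>2) \<and>
      L2_norm strip (\<lambda>x. vel (s t) x - couette_vel x) \<le> ennreal (C * eps q) \<and>
      L2_norm strip (\<lambda>x. temp (s t) x - couette_temp q x) \<le> ennreal (C * (eps q)\<^sup>2)"
proof -
  have "0 < Reynolds p"
    using assms(1) by (simp add: admissible_def)
  then have "0 < Reynolds p \<and> Reynolds p < Re'"
    using assms(4) by simp
  from mp[OF spec[OF ge[unfolded global_existence_def]] this] obtain C where C: "0 < C"
    and ex: "\<forall>m c s0. let q = p\<lparr>Reynolds := Reynolds p, Mach := m, chi := c\<rparr> in
          0 < m \<and> 0 < c \<and> \<bar>1 - c\<bar> \<le> K * eps q \<and> eps q < eps' (Reynolds p) \<and>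
          initial_conditions q (C0 (Reynolds p)) s0 \<longrightarrow>
            (\<exists>s. strong_solution q s0 s \<and> uniform_bounds q C s \<and> decays q s) \<and>
            (\<forall>s s'. strong_solution q s0 s \<and> strong_solution q s0 s' \<longrightarrow> same_solution s s')"
    by (elim exE conjE)
  show ?thesis
  proof (rule that[OF C])
    fix q m s0 s and t :: real
    assume q: "q = p\<lparr>Mach := m\<rparr>" and m: "0 < m" and small: "eps q < eps' (Reynolds p)"
      and ic: "initial_conditions q (C0 (Reynolds p)) s0" and sol: "strong_solution q s0 s" and t: "0 \<le> t"
    have pos: "0 < eps q"
      using assms(1) m by (simp add: q eps_def admissible_def)
    have q': "p\<lparr>Reynolds := Reynolds p, Mach := m, chi := 1\<rparr> = q"
      using assms(2) by (cases p) (simp add: q)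
    \<comment> \<open>The existence property is used with wall temperature \<open>1\<close>, where \<open>\<bar>1 - \<chi>\<bar> = O(\<epsilon>)\<close> reads \<open>0 \<le> K \<epsilon>\<close>.\<close>
    have "0 \<le> K * eps q"
      using assms(3) pos by simp
    then obtain s' where s': "strong_solution q s0 s'" "uniform_bounds q C s'"
      and uniq: "\<And>s s'. strong_solution q s0 s \<Longrightarrow> strong_solution q s0 s' \<Longrightarrow> same_solution s s'"
      using spec[OF spec[OF spec[OF ex, of m], of 1], of s0] m small ic unfolding q' Let_def by auto
    have same: "AE x\<in>strip in lebesgue. dens (s t) x = dens (s' t) x
        \<and> vel (s t) x = vel (s' t) x \<and> temp (s t) x = temp (s' t) x"
      using uniq[OF sol s'(1)] t by (simp add: same_solution_def)
    have eq: "L2_norm strip (\<lambda>x. dens (s t) x - couette_dens q x) = L2_norm strip (\<lambda>x. dens (s' t) x - couette_dens q x)"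
      "L2_norm strip (\<lambda>x. vel (s t) x - couette_vel x) = L2_norm strip (\<lambda>x. vel (s' t) x - couette_vel x)"
      "L2_norm strip (\<lambda>x. temp (s t) x - couette_temp q x) = L2_norm strip (\<lambda>x. temp (s' t) x - couette_temp q x)"
      by (rule L2_norm_cong_AE, use same in eventually_elim, simp)+
    have sum: "ennreal (1 / eps q) * L2_norm strip (\<lambda>x. dens (s' t) x - couette_dens q x)
        + L2_norm strip (\<lambda>x. vel (s' t) x - couette_vel x)
        + ennreal (1 / eps q) * L2_norm strip (\<lambda>x. temp (s' t) x - couette_temp q x) \<le> ennreal (C * eps q)"
      (is "?d + ?v + ?T \<le> _")
      using s'(2) t by (simp add: uniform_bounds_def perturbation_def SUP_le_iff)
    have "?d \<le> ?d + ?v + ?T" "?v \<le> ?d + ?v + ?T" "?T \<le> ?d + ?v + ?T"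
      by (simp_all add: add_increasing add_increasing2)
    with sum have "?d \<le> ennreal (C * eps q)" "?v \<le> ennreal (C * eps q)" "?T \<le> ennreal (C * eps q)"
      by (meson order_trans)+
    then show "L2_norm strip (\<lambda>x. dens (s t) x - couette_dens q x) \<le> ennreal (C * (eps q)\<^sup>2) \<and>
      L2_norm strip (\<lambda>x. vel (s t) x - couette_vel x) \<le> ennreal (C * eps q) \<and>
      L2_norm strip (\<lambda>x. temp (s t) x - couette_temp q x) \<le> ennreal (C * (eps q)\<^sup>2)"
      unfolding eq using pos by (simp add: ennreal_le_of_inverse_mult_le)
  qed
qed

lemma strong_solution_in_L2_space:
  assumes "strong_solution p s0 s" "0 \<le> t"
  shows "(\<lambda>x. dens (s t) x - couette_dens p x) \<in> L2_space strip"
    and "(\<lambda>x. temp (s t) x - couette_temp p x) \<in> L2_space strip"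
proof -
  have "dens (perturbation p (s t)) \<in> H 3" "temp (perturbation p (s t)) \<in> H 3"
    using assms unfolding strong_solution_def C_in_H_def by blast+
  then show "(\<lambda>x. dens (s t) x - couette_dens p x) \<in> L2_space strip"
    and "(\<lambda>x. temp (s t) x - couette_temp p x) \<in> L2_space strip"
    using H_subset_L2_space[of 3] by (auto simp: perturbation_def)
qed


section \<open>The incompressible Couette flow\<close>

lemma pd_bounded_linear:
  assumes "bounded_linear f"
  shows "pd e f = (\<lambda>_. f e)"
proof -
  have "frechet_derivative f (at x) = f" for x
    using frechet_derivative_at[OF bounded_linear_imp_has_derivative[OF assms]] by (rule sym)
  then show ?thesis by (simp add: pd_def[abs_def])
qed

lemma pd_const [simp]: "pd e (\<lambda>_. c) = (\<lambda>_. 0)"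
  by (simp add: pd_def fun_eq_iff)

lemma Ck_on_const [simp]: "Ck_on k S (\<lambda>_. c)"
  by (induction k arbitrary: c) auto

lemma Ck_on_bounded_linear:
  assumes "bounded_linear f"
  shows "Ck_on k S f"
  using assms
  by (cases k) (auto simp: pd_bounded_linear linear_continuous_on
      intro: bounded_linear_imp_differentiable_on)

lemma steady_incompressible_NS_couette: "steady_incompressible_NS \<mu> couette_vel (\<lambda>_. c)"
proof -
  have lin: "bounded_linear couette_vel"
    unfolding couette_vel_def[abs_def]
    by (intro bounded_linear_Pair bounded_linear_snd bounded_linear_zero)
  have cmpt_lin: "bounded_linear (cmpt couette_vel e)" for e
    unfolding cmpt_def
    by (rule bounded_linear_compose[OF bounded_linear_inner_left lin])
  show ?thesis
    unfolding steady_incompressible_NS_def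
    using Ck_on_bounded_linear[OF cmpt_lin] linear_continuous_on[OF lin]
    unfolding pd_bounded_linear[OF cmpt_lin]
    by (auto simp: cmpt_def couette_vel_def Basis_prod_def zero_prod_def sum.union_disjoint)
qed


section \<open>The low Mach number limit\<close>

lemma ennreal_tendsto_zero_of_eventually_le:
  fixes f :: "'a \<Rightarrow> ennreal" and g :: "'a \<Rightarrow> real"
  assumes "eventually (\<lambda>m. f m \<le> ennreal (g m)) F" "(g \<longlongrightarrow> 0) F"
  shows "(f \<longlongrightarrow> 0) F"
proof (rule tendsto_sandwich[OF _ assms(1) tendsto_const])
  show "((\<lambda>m. ennreal (g m)) \<longlongrightarrow> 0) F"
    using tendsto_ennrealI[OF assms(2)] by simp
qed simp

theorem theorem1p2:
  fixes p :: flow_params and K Re' :: real and eps' C0 :: "real \<Rightarrow> real"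
  assumes "admissible p" and "chi p = 1"
    and "K > 0" and "Re' > 0" and "\<And>R. 0 < R \<Longrightarrow> R < Re' \<Longrightarrow> eps' R > 0 \<and> C0 R > 0"
    and "global_existence K p Re' eps' C0"
    and "Reynolds p < Re'"
  shows
    "(\<exists>C>0. \<forall>m s0 s. let q = p\<lparr>Mach := m\<rparr>; \<epsilon> = eps q in
        0 < m \<and> \<epsilon> < eps' (Reynolds p) \<and> initial_conditions q (C0 (Reynolds p)) s0 \<and> strong_solution q s0 s \<longrightarrow>
          (\<forall>t\<ge>0.
             L2_norm strip (\<lambda>x. dens (s t) x - couette_dens q x) \<le> ennreal (C * \<epsilon>\<^sup>2) \<and>
             L2_uloc (\<lambda>x. dens (s t) x - 1) \<le> ennreal (C * \<epsilon>\<^sup>2) \<and>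
             L2_norm strip (\<lambda>x. vel (s t) x - couette_vel x) \<le> ennreal (C * \<epsilon>) \<and>
             L2_norm strip (\<lambda>x. temp (s t) x - couette_temp q x) \<le> ennreal (C * \<epsilon>\<^sup>2) \<and>
             L2_uloc (\<lambda>x. temp (s t) x - 1) \<le> ennreal (C * \<epsilon>\<^sup>2)))
     \<and> steady_incompressible_NS (mu p) couette_vel (\<lambda>_. pressure 1 1)
     \<and> (\<forall>s0 s.
          (\<forall>m>0. let q = p\<lparr>Mach := m\<rparr> in
             eps q < eps' (Reynolds p) \<longrightarrow>
               initial_conditions q (C0 (Reynolds p)) (s0 m) \<and> strong_solution q (s0 m) (s m)) \<longrightarrow>
          ((\<lambda>m. SUP t\<in>{0..}. L2_uloc (\<lambda>x. dens (s m t) x - 1)) \<longlongrightarrow> 0) (at_right 0) \<and>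
          ((\<lambda>m. SUP t\<in>{0..}. L2_norm strip (\<lambda>x. vel (s m t) x - couette_vel x)) \<longlongrightarrow> 0) (at_right 0) \<and>
          ((\<lambda>m. SUP t\<in>{0..}. L2_uloc (\<lambda>x. temp (s m t) x - 1)) \<longlongrightarrow> 0) (at_right 0))"
proof -
  let ?k = "Prandtl p / (8 * C_p p)"
  have k: "0 \<le> ?k"
    using assms(1) by (simp add: admissible_def)
  obtain C where C: "0 < C"
    and near: "\<And>q m s0 s t. \<lbrakk>q = p\<lparr>Mach := m\<rparr>; 0 < m; eps q < eps' (Reynolds p);
        initial_conditions q (C0 (Reynolds p)) s0; strong_solution q s0 s; 0 \<le> t\<rbrakk> \<Longrightarrow>
      L2_norm strip (\<lambda>x. dens (s t) x - couette_dens q x) \<le> ennreal (C * (eps q)\<^sup>2) \<and>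
      L2_norm strip (\<lambda>x. vel (s t) x - couette_vel x) \<le> ennreal (C * eps q) \<and>
      L2_norm strip (\<lambda>x. temp (s t) x - couette_temp q x) \<le> ennreal (C * (eps q)\<^sup>2)"
    using strong_solution_near_couette[OF assms(1,2,3,7,6)] by blast
  let ?B = "2 * (C + ?k)"
  have B: "0 < ?B" "C \<le> ?B"
    using C k by auto
  have bounds: "L2_norm strip (\<lambda>x. dens (s t) x - couette_dens q x) \<le> ennreal (?B * (eps q)\<^sup>2) \<and>
      L2_uloc (\<lambda>x. dens (s t) x - 1) \<le> ennreal (?B * (eps q)\<^sup>2) \<and>
      L2_norm strip (\<lambda>x. vel (s t) x - couette_vel x) \<le> ennreal (?B * eps q) \<and>
      L2_norm strip (\<lambda>x. temp (s t) x - couette_temp q x) \<le> ennreal (?B * (eps q)\<^sup>2) \<and>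
      L2_uloc (\<lambda>x. temp (s t) x - 1) \<le> ennreal (?B * (eps q)\<^sup>2)"
    if q: "q = p\<lparr>Mach := m\<rparr>" and m: "0 < m" and small: "eps q < eps' (Reynolds p)"
      and ic: "initial_conditions q (C0 (Reynolds p)) s0" and sol: "strong_solution q s0 s"
      and t: "0 \<le> t" for q m s0 s t
  proof -
    have adm: "admissible q" and chi: "chi q = 1"
      using assms(1,2) m by (simp_all add: q admissible_def mu_def mu'_def)
    have k_eq: "Prandtl q / (8 * C_p q) = ?k"
      by (simp add: q)
    have pos: "0 < eps q"
      using adm by (simp add: eps_def admissible_def)
    have B_eq: "2 * (C * (eps q)\<^sup>2 + ?k * (eps q)\<^sup>2) = ?B * (eps q)\<^sup>2"
      by (simp add: algebra_simps)
    have nonneg: "0 \<le> C * (eps q)\<^sup>2" "0 \<le> ?k * (eps q)\<^sup>2"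
      using C mult_nonneg_nonneg[OF k, of "(eps q)\<^sup>2"] by simp_all
    note n = near[OF that]
    have "L2_uloc (\<lambda>x. dens (s t) x - 1) \<le> ennreal (?B * (eps q)\<^sup>2)"
      unfolding B_eq[symmetric]
      by (rule L2_uloc_le_of_near_bounded[OF strong_solution_in_L2_space(1)[OF sol t] _
            couette_dens_near_one[OF adm chi, unfolded k_eq] nonneg]) (use n in blast)+
    moreover have "L2_uloc (\<lambda>x. temp (s t) x - 1) \<le> ennreal (?B * (eps q)\<^sup>2)"
      unfolding B_eq[symmetric]
      by (rule L2_uloc_le_of_near_bounded[OF strong_solution_in_L2_space(2)[OF sol t] _
            couette_temp_near_one[OF adm chi, unfolded k_eq] nonneg]) (use n in blast)+
    moreover have "ennreal (C * (eps q)\<^sup>2) \<le> ennreal (?B * (eps q)\<^sup>2)"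
        "ennreal (C * eps q) \<le> ennreal (?B * eps q)"
      using B pos by (intro ennreal_leI mult_right_mono; simp)+
    ultimately show ?thesis
      using n by (meson order_trans)
  qed
  have limits: "((\<lambda>m. SUP t\<in>{0..}. L2_uloc (\<lambda>x. dens (s m t) x - 1)) \<longlongrightarrow> 0) (at_right 0) \<and>
      ((\<lambda>m. SUP t\<in>{0..}. L2_norm strip (\<lambda>x. vel (s m t) x - couette_vel x)) \<longlongrightarrow> 0) (at_right 0) \<and>
      ((\<lambda>m. SUP t\<in>{0..}. L2_uloc (\<lambda>x. temp (s m t) x - 1)) \<longlongrightarrow> 0) (at_right 0)"
    if fam: "\<forall>m>0. let q = p\<lparr>Mach := m\<rparr> in eps q < eps' (Reynolds p) \<longrightarrow>
        initial_conditions q (C0 (Reynolds p)) (s0 m) \<and> strong_solution q (s0 m) (s m)" for s0 s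
  proof -
    have eps0: "((\<lambda>m. eps (p\<lparr>Mach := m\<rparr>)) \<longlongrightarrow> 0) (at_right 0)"
      by (auto simp: eps_def intro!: tendsto_eq_intros)
    have lim1: "((\<lambda>m. ?B * eps (p\<lparr>Mach := m\<rparr>)) \<longlongrightarrow> 0) (at_right 0)"
      using tendsto_mult_right_zero[OF eps0] .
    have lim2: "((\<lambda>m. ?B * (eps (p\<lparr>Mach := m\<rparr>))\<^sup>2) \<longlongrightarrow> 0) (at_right 0)"
      using tendsto_mult_right_zero[OF tendsto_null_power[OF eps0, of 2]] by simp
    have "0 < Reynolds p"
      using assms(1) by (simp add: admissible_def)
    then have "eventually (\<lambda>m. eps (p\<lparr>Mach := m\<rparr>) < eps' (Reynolds p)) (at_right 0)"
      using assms(5,7) by (intro order_tendstoD(2)[OF eps0]) auto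
    moreover have "eventually (\<lambda>m::real. 0 < m) (at_right 0)"
      by (rule eventually_at_right_less)
    ultimately have "eventually (\<lambda>m.
        (SUP t\<in>{0..}. L2_uloc (\<lambda>x. dens (s m t) x - 1)) \<le> ennreal (?B * (eps (p\<lparr>Mach := m\<rparr>))\<^sup>2) \<and>
        (SUP t\<in>{0..}. L2_norm strip (\<lambda>x. vel (s m t) x - couette_vel x)) \<le> ennreal (?B * eps (p\<lparr>Mach := m\<rparr>)) \<and>
        (SUP t\<in>{0..}. L2_uloc (\<lambda>x. temp (s m t) x - 1)) \<le> ennreal (?B * (eps (p\<lparr>Mach := m\<rparr>))\<^sup>2))
      (at_right 0)"
    proof eventually_elim
      case (elim m)
      then have "initial_conditions (p\<lparr>Mach := m\<rparr>) (C0 (Reynolds p)) (s0 m)"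
          "strong_solution (p\<lparr>Mach := m\<rparr>) (s0 m) (s m)"
        using fam by (simp_all add: Let_def)
      note b = bounds[OF refl elim(2,1) this]
      show ?case
        using b by (intro conjI SUP_least) auto
    qed
    then have ev: "eventually (\<lambda>m. (SUP t\<in>{0..}. L2_uloc (\<lambda>x. dens (s m t) x - 1))
          \<le> ennreal (?B * (eps (p\<lparr>Mach := m\<rparr>))\<^sup>2)) (at_right 0)"
        "eventually (\<lambda>m. (SUP t\<in>{0..}. L2_norm strip (\<lambda>x. vel (s m t) x - couette_vel x))
          \<le> ennreal (?B * eps (p\<lparr>Mach := m\<rparr>))) (at_right 0)"
        "eventually (\<lambda>m. (SUP t\<in>{0..}. L2_uloc (\<lambda>x. temp (s m t) x - 1))
          \<le> ennreal (?B * (eps (p\<lparr>Mach := m\<rparr>))\<^sup>2)) (at_right 0)"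
      by (simp_all only: eventually_conj_iff)
    show ?thesis
      using ennreal_tendsto_zero_of_eventually_le[OF ev(1) lim2]
        ennreal_tendsto_zero_of_eventually_le[OF ev(2) lim1]
        ennreal_tendsto_zero_of_eventually_le[OF ev(3) lim2] by blast
  qed
  show ?thesis
  proof (intro conjI)
    show "\<exists>C>0. \<forall>m s0 s. let q = p\<lparr>Mach := m\<rparr>; \<epsilon> = eps q in
        0 < m \<and> \<epsilon> < eps' (Reynolds p) \<and> initial_conditions q (C0 (Reynolds p)) s0 \<and> strong_solution q s0 s \<longrightarrow>
          (\<forall>t\<ge>0.
             L2_norm strip (\<lambda>x. dens (s t) x - couette_dens q x) \<le> ennreal (C * \<epsilon>\<^sup>2) \<and>
             L2_uloc (\<lambda>x. dens (s t) x - 1) \<le> ennreal (C * \<epsilon>\<^sup>2) \<and>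
             L2_norm strip (\<lambda>x. vel (s t) x - couette_vel x) \<le> ennreal (C * \<epsilon>) \<and>
             L2_norm strip (\<lambda>x. temp (s t) x - couette_temp q x) \<le> ennreal (C * \<epsilon>\<^sup>2) \<and>
             L2_uloc (\<lambda>x. temp (s t) x - 1) \<le> ennreal (C * \<epsilon>\<^sup>2))"
      unfolding Let_def
      by (rule exI[of _ ?B], rule conjI[OF B(1)], intro allI impI, elim conjE) (rule bounds[OF refl])
  qed (rule steady_incompressible_NS_couette, intro allI impI, erule limits)
qed

end
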